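(* Let $G$ be a group, $M=G^0=G\sqcup\{0\}$ the monoid obtained from $G$ by adjoining a zero element, $e$ its identity, and $\alpha$ a strong partial action of $M$ on a semigroup $X$ such that $\operatorname{dom}\alpha_m$ and $\operatorname{im}\alpha_m$ are ideals of $X$ for all $m\in M$. Suppose that: (LC1) for all $g\in G$ and $x,y,z\in X$ with $y\in\operatorname{dom}\alpha_g$: $\alpha_{g^{-1}}(\alpha_g(xy)z)=x\,\alpha_{g^{-1}}(\alpha_g(y)z)$; (LC2) for all $m\in M$, $y\in\operatorname{dom}\alpha_m$ and $x,z\in X^1$: if $xyz\in\operatorname{dom}\alpha_0$, then $x\alpha_m(y)z\in\operatorname{dom}\alpha_0$ and $\alpha_0(xyz)=\alpha_0(x\alpha_m(y)z)$. Let $\overline{\beta}=\{\overline{\beta}_n\}_{n\in M}$ be the global action of $M$ on $X_M^+/R^\#$ given on generators by $\overline{\beta}_n([m,x])=[nm,x]$, and let $\overline{\iota}:X\to X_M^+/R^\#$, $\overline{\iota}(x)=[e,x]$. Then $(\overline{\beta},\overline{\iota})$ is a universal globalization of $\alpha$ (in the category of semigroups).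
   Context: Let $M$ be a monoid with identity $e$. A strong partial action of $M$ on a set $X$ is a family $\alpha=\{\alpha_m:\operatorname{dom}\alpha_m\to X\}_{m\in M}$ of maps with $\operatorname{dom}\alpha_m\subseteq X$ such that: (1) $\operatorname{dom}\alpha_e=X$ and $\alpha_e=\mathrm{id}_X$; (2) $\alpha_m^{-1}(\operatorname{dom}\alpha_n)=\operatorname{dom}\alpha_{nm}\cap\operatorname{dom}\alpha_m$ for all $m,n\in M$; (3) $\alpha_n\circ\alpha_m=\alpha_{nm}$ on $\alpha_m^{-1}(\operatorname{dom}\alpha_n)$ for all $m,n\in M$. It is a global action if $\operatorname{dom}\alpha_m=X$ for all $m$. A strong partial action (global action) of $M$ on a semigroup $X$ is one on the underlying set such that each $\operatorname{dom}\alpha_m$ is a subsemigroup of $X$ and each $\alpha_m$ is a semigroup homomorphism. Write $\operatorname{im}\alpha_m=\alpha_m(\operatorname{dom}\alpha_m)$. Ideals are two-sided; subsemigroups and ideals are allowed to be empty. $X^1$ denotes the semigroup $X$ with an identity element $1$ adjoined. If $\alpha$ is a strong partial action of $M$ on a semigroup $X$ and $\beta$ is a global action of $M$ on a semigroup $Y$, a morphism $\iota:\alpha\to\beta$ is a semigroup homomorphism $\iota:X\to Y$ with $\beta_m(\iota(x))=\iota(\alpha_m(x))$ for all $m\in M$, $x\in\operatorname{dom}\alpha_m$ (morphisms between global actions are defined in the same way). A globalization of $\alpha$ is a pair $(\beta,\iota)$, with $\beta$ a global action of $M$ on a semigroup and $\iota:\alpha\to\beta$ a morphism, such that for all $x,y\in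 X$ and $m\in M$ with $\beta_m(\iota(x))=\iota(y)$ one has $x\in\operatorname{dom}\alpha_m$ and $\alpha_m(x)=y$. It is universal if for any globalization $(\gamma,\kappa)$ of $\alpha$ there is a unique morphism $\kappa':\beta\to\gamma$ with $\kappa'\circ\iota=\kappa$. $X_M=(M\times X)/{\approx}$, where $\approx$ is the equivalence relation generated by: $(m,x)\rightharpoonup(n,y)$ iff there is $k\in M$ with $m=nk$, $x\in\operatorname{dom}\alpha_k$ and $y=\alpha_k(x)$. The class of $(m,x)$ is $[m,x]$. $X_M^+$ is the free semigroup on $X_M$ (nonempty words). $R^\#$ is the congruence on $X_M^+$ generated by all pairs $([m,x][m,y],[m,xy])$ with $m\in M$, $x,y\in X$; the $R^\#$-class of a word is denoted by the word itself. The maps $\overline\beta_n$ are well-defined semigroup endomorphisms of $X_M^+/R^\#$ forming a global action, and $\overline\iota$ is a morphism $\alpha\to\overline\beta$. *)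

theory Defs
  imports "HOL-Algebra.Group" "HOL.Hull"
begin

section \<open>Semigroups, possibly empty\<close>

record 'a magma = "'a partial_object" +
  op :: "'a \<Rightarrow> 'a \<Rightarrow> 'a" (infixl "\<cdot>\<index>" 70)

locale semigrp =
  fixes S :: "'a magma" (structure)
  assumes op_closed: "\<lbrakk>x \<in> carrier S; y \<in> carrier S\<rbrakk> \<Longrightarrow> x \<cdot> y \<in> carrier S"
    and op_assoc: "\<lbrakk>x \<in> carrier S; y \<in> carrier S; z \<in> carrier S\<rbrakk>
      \<Longrightarrow> (x \<cdot> y) \<cdot> z = x \<cdot> (y \<cdot> z)"

definition subsemigrp :: "'a set \<Rightarrow> 'a magma \<Rightarrow> bool" where
  "subsemigrp T S \<longleftrightarrow> T \<subseteq> carrier S \<and> (\<forall>x\<in>T. \<forall>y\<in>T. x \<cdot>\<^bsub>S\<^esub> y \<in> T)"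

definition semigrp_ideal :: "'a set \<Rightarrow> 'a magma \<Rightarrow> bool" where
  "semigrp_ideal I S \<longleftrightarrow> I \<subseteq> carrier S \<and>
     (\<forall>a\<in>I. \<forall>x\<in>carrier S. a \<cdot>\<^bsub>S\<^esub> x \<in> I \<and> x \<cdot>\<^bsub>S\<^esub> a \<in> I)"

definition semigrp_hom :: "'a magma \<Rightarrow> 'b magma \<Rightarrow> ('a \<Rightarrow> 'b) set" where
  "semigrp_hom S T = {f \<in> carrier S \<rightarrow> carrier T.
     \<forall>x\<in>carrier S. \<forall>y\<in>carrier S. f (x \<cdot>\<^bsub>S\<^esub> y) = f x \<cdot>\<^bsub>T\<^esub> f y}"

text \<open>The semigroup \<open>X\<^sup>1\<close>; the new identity is \<^term>\<open>None\<close>, and it is adjoined even if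
  \<open>X\<close> already has an identity.\<close>

definition adjoin_one :: "'a magma \<Rightarrow> 'a option magma" where
  "adjoin_one S = \<lparr>carrier = insert None (Some ` carrier S),
     op = (\<lambda>a b. case (a, b) of
        (None, _) \<Rightarrow> b
      | (_, None) \<Rightarrow> a
      | (Some x, Some y) \<Rightarrow> Some (x \<cdot>\<^bsub>S\<^esub> y))\<rparr>"

text \<open>The monoid \<open>G\<^sup>0\<close>; the new zero is \<^term>\<open>None\<close>.\<close>

definition adjoin_zero :: "('g, 'b) monoid_scheme \<Rightarrow> 'g option monoid" where
  "adjoin_zero G = \<lparr>carrier = insert None (Some ` carrier G),
     mult = (\<lambda>a b. case (a, b) of
        (Some g, Some h) \<Rightarrow> Some (g \<otimes>\<^bsub>G\<^esub> h)
      | _ \<Rightarrow> None),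
     one = Some \<one>\<^bsub>G\<^esub>\<rparr>"


section \<open>Strong partial actions and globalizations\<close>

text \<open>A family of partial maps is given by its domains \<open>D m\<close> together with total functions
  \<open>\<alpha> m\<close>, whose values outside \<open>D m\<close> are irrelevant.\<close>

definition strong_partial_action_on ::
  "'m monoid \<Rightarrow> 'x set \<Rightarrow> ('m \<Rightarrow> 'x set) \<Rightarrow> ('m \<Rightarrow> 'x \<Rightarrow> 'x) \<Rightarrow> bool" where
  "strong_partial_action_on M A D \<alpha> \<longleftrightarrow>
     (\<forall>m\<in>carrier M. D m \<subseteq> A \<and> \<alpha> m \<in> D m \<rightarrow> A) \<and>
     D \<one>\<^bsub>M\<^esub> = A \<and> (\<forall>x\<in>A. \<alpha> \<one>\<^bsub>M\<^esub> x = x) \<and>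
     (\<forall>m\<in>carrier M. \<forall>n\<in>carrier M. {x \<in> D m. \<alpha> m x \<in> D n} = D (n \<otimes>\<^bsub>M\<^esub> m) \<inter> D m) \<and>
     (\<forall>m\<in>carrier M. \<forall>n\<in>carrier M. \<forall>x\<in>D m.
        \<alpha> m x \<in> D n \<longrightarrow> \<alpha> n (\<alpha> m x) = \<alpha> (n \<otimes>\<^bsub>M\<^esub> m) x)"

definition strong_partial_action ::
  "'m monoid \<Rightarrow> 'x magma \<Rightarrow> ('m \<Rightarrow> 'x set) \<Rightarrow> ('m \<Rightarrow> 'x \<Rightarrow> 'x) \<Rightarrow> bool" where
  "strong_partial_action M X D \<alpha> \<longleftrightarrow>
     strong_partial_action_on M (carrier X) D \<alpha> \<and>
     (\<forall>m\<in>carrier M. subsemigrp (D m) X \<and> \<alpha> m \<in> semigrp_hom (X\<lparr>carrier := D m\<rparr>) X)"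

definition global_action :: "'m monoid \<Rightarrow> 'y magma \<Rightarrow> ('m \<Rightarrow> 'y \<Rightarrow> 'y) \<Rightarrow> bool" where
  "global_action M Y \<beta> \<longleftrightarrow> strong_partial_action M Y (\<lambda>_. carrier Y) \<beta>"

definition action_morphism ::
  "'m monoid \<Rightarrow> 'x magma \<Rightarrow> ('m \<Rightarrow> 'x set) \<Rightarrow> ('m \<Rightarrow> 'x \<Rightarrow> 'x) \<Rightarrow>
   'y magma \<Rightarrow> ('m \<Rightarrow> 'y \<Rightarrow> 'y) \<Rightarrow> ('x \<Rightarrow> 'y) \<Rightarrow> bool" where
  "action_morphism M X D \<alpha> Y \<beta> \<iota> \<longleftrightarrow>
     \<iota> \<in> semigrp_hom X Y \<and> (\<forall>m\<in>carrier M. \<forall>x\<in>D m. \<beta> m (\<iota> x) = \<iota> (\<alpha> m x))"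

definition globalization ::
  "'m monoid \<Rightarrow> 'x magma \<Rightarrow> ('m \<Rightarrow> 'x set) \<Rightarrow> ('m \<Rightarrow> 'x \<Rightarrow> 'x) \<Rightarrow>
   'y magma \<Rightarrow> ('m \<Rightarrow> 'y \<Rightarrow> 'y) \<Rightarrow> ('x \<Rightarrow> 'y) \<Rightarrow> bool" where
  "globalization M X D \<alpha> Y \<beta> \<iota> \<longleftrightarrow>
     semigrp Y \<and> global_action M Y \<beta> \<and> action_morphism M X D \<alpha> Y \<beta> \<iota> \<and>
     (\<forall>x\<in>carrier X. \<forall>y\<in>carrier X. \<forall>m\<in>carrier M.
        \<beta> m (\<iota> x) = \<iota> y \<longrightarrow> x \<in> D m \<and> \<alpha> m x = y)"

text \<open>The type argument is the type over which the competing globalizations range; a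
  theorem that is polymorphic in it covers all semigroups. Maps on \<open>Y\<close> are made
  \<^const>\<open>extensional\<close> so that uniqueness means equality on the carrier.\<close>

definition universal_globalization ::
  "'z itself \<Rightarrow> 'm monoid \<Rightarrow> 'x magma \<Rightarrow> ('m \<Rightarrow> 'x set) \<Rightarrow> ('m \<Rightarrow> 'x \<Rightarrow> 'x) \<Rightarrow>
   'y magma \<Rightarrow> ('m \<Rightarrow> 'y \<Rightarrow> 'y) \<Rightarrow> ('x \<Rightarrow> 'y) \<Rightarrow> bool" where
  "universal_globalization (_ :: 'z itself) M X D \<alpha> Y \<beta> \<iota> \<longleftrightarrow>
     globalization M X D \<alpha> Y \<beta> \<iota> \<and>
     (\<forall>(Z :: 'z magma) \<gamma> \<kappa>. globalization M X D \<alpha> Z \<gamma> \<kappa> \<longrightarrow>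
        (\<exists>!\<kappa>'. \<kappa>' \<in> extensional (carrier Y) \<and>
              action_morphism M Y (\<lambda>_. carrier Y) \<beta> Z \<gamma> \<kappa>' \<and>
              (\<forall>x\<in>carrier X. \<kappa>' (\<iota> x) = \<kappa> x)))"


section \<open>Free semigroups and quotients by generated congruences\<close>

definition free_semigrp :: "'a set \<Rightarrow> 'a list magma" where
  "free_semigrp A = \<lparr>carrier = lists A - {[]}, op = (@)\<rparr>"

definition congruence :: "'a magma \<Rightarrow> 'a rel \<Rightarrow> bool" where
  "congruence S r \<longleftrightarrow> equiv (carrier S) r \<and>
     (\<forall>(a, b)\<in>r. \<forall>(c, d)\<in>r. (a \<cdot>\<^bsub>S\<^esub> c, b \<cdot>\<^bsub>S\<^esub> d) \<in> r)"

definition quotient_semigrp :: "'a magma \<Rightarrow> 'a rel \<Rightarrow> 'a set magma" where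
  "quotient_semigrp S r = \<lparr>carrier = carrier S // r,
     op = (\<lambda>A B. \<Union>a\<in>A. \<Union>b\<in>B. r `` {a \<cdot>\<^bsub>S\<^esub> b})\<rparr>"


section \<open>The semigroup \<open>X\<^sub>M\<^sup>+/R\<^sup>#\<close> and the action on it\<close>

context
  fixes M :: "'m monoid" (structure)
    and X :: "'x magma"
    and D :: "'m \<Rightarrow> 'x set"
    and \<alpha> :: "'m \<Rightarrow> 'x \<Rightarrow> 'x"
begin

definition XM_arrow :: "('m \<times> 'x) rel" where
  "XM_arrow = {((m, x), (n, y)) | m x n y.
     m \<in> carrier M \<and> n \<in> carrier M \<and> x \<in> carrier X \<and> y \<in> carrier X \<and>
     (\<exists>k\<in>carrier M. m = n \<otimes> k \<and> x \<in> D k \<and> y = \<alpha> k x)}"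

definition XM_rel :: "('m \<times> 'x) rel" where
  "XM_rel = equiv (carrier M \<times> carrier X) hull XM_arrow"

definition XM :: "('m \<times> 'x) set set" where
  "XM = (carrier M \<times> carrier X) // XM_rel"

definition XM_class :: "'m \<Rightarrow> 'x \<Rightarrow> ('m \<times> 'x) set" where
  "XM_class m x = XM_rel `` {(m, x)}"

definition R_cong :: "('m \<times> 'x) set list rel" where
  "R_cong = congruence (free_semigrp XM) hull
     {([XM_class m x, XM_class m y], [XM_class m (x \<cdot>\<^bsub>X\<^esub> y)]) | m x y.
        m \<in> carrier M \<and> x \<in> carrier X \<and> y \<in> carrier X}"

definition XM_semigrp :: "('m \<times> 'x) set list set magma" where
  "XM_semigrp = quotient_semigrp (free_semigrp XM) R_cong"

text \<open>Both maps are defined on a class by a union over its representatives; all of these yield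
  the same class. \<open>beta_bar n\<close> acts letterwise, so it sends the class of \<open>[m, x]\<close> to that
  of \<open>[nm, x]\<close> and is multiplicative.\<close>

definition XM_act :: "'m \<Rightarrow> ('m \<times> 'x) set \<Rightarrow> ('m \<times> 'x) set" where
  "XM_act n c = (\<Union>(m, x)\<in>c. XM_class (n \<otimes> m) x)"

definition beta_bar :: "'m \<Rightarrow> ('m \<times> 'x) set list set \<Rightarrow> ('m \<times> 'x) set list set" where
  "beta_bar n C = (\<Union>w\<in>C. R_cong `` {map (XM_act n) w})"

definition iota_bar :: "'x \<Rightarrow> ('m \<times> 'x) set list set" where
  "iota_bar x = R_cong `` {[XM_class \<one> x]}"

end

end

theory Submission
  imports Defs "HOL-Library.Confluence"
begin

text \<open>The universal property holds over any monoid, because a morphism \<open>\<alpha> \<rightarrow> \<gamma>\<close> extends to words by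
  \<open>[m, x] \<mapsto> \<gamma>\<^sub>m(\<kappa>(x))\<close>. What remains is that \<open>[m, x]\<close> and \<open>[e, y]\<close> are congruent words only
  if \<open>\<alpha>\<^sub>m(x) = y\<close>. Contracting \<open>[m, x][m, y]\<close> to \<open>[m, xy]\<close> shortens words, so congruent single
  letters are equal once contraction is confluent. Since all \<open>[g, X]\<close> meet in ideals, the only
  critical pairs are \<open>[g, x][g, y][h, z]\<close> with \<open>[g, y]\<close> also in \<open>[h, X]\<close>, and they are joined in one
  step by (LC1). In \<open>[0, X]\<close> a letter has many labels and contraction is multivalued; there
  \<open>X\<close> is first divided by the syntactic congruence of \<open>\<alpha>\<^sub>0\<close>, which by (LC2) still separates
  the points of \<open>im \<alpha>\<^sub>0\<close>.\<close>

section \<open>Generated equivalences and congruences\<close>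

lemma equiv_kernel: "equiv A {(a, b). a \<in> A \<and> b \<in> A \<and> f a = f b}"
  by (auto intro!: equivI refl_onI symI transI)

lemma equiv_hull:
  assumes "r \<subseteq> A \<times> A"
  shows "equiv A (equiv A hull r)"
proof (rule equivI)
  show "equiv A hull r \<subseteq> A \<times> A"
    \<comment> \<open>The kernel of a constant map is \<open>A \<times> A\<close>, so the full
      relation is one of the equivalences intersected in the hull.\<close>
    using assms equiv_kernel[of A "\<lambda>_. ()"] by (intro hull_minimal) (auto simp: Sigma_def)
  show "refl_on A (equiv A hull r)"
    by (auto simp: hull_def refl_on_def equiv_def)
  show "sym (equiv A hull r)"
    unfolding hull_def equiv_def by (rule symI) (blast dest: symD)
  show "trans (equiv A hull r)"
    unfolding hull_def equiv_def by (rule transI) (blast dest: transD)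
qed

text \<open>The kernel of \<open>f\<close> is an equivalence containing \<open>r\<close>, hence
  contains the hull; this replaces induction along chains of generating pairs.\<close>

lemma equiv_hull_respects:
  assumes "\<And>a b. (a, b) \<in> r \<Longrightarrow> a \<in> A \<and> b \<in> A \<and> f a = f b"
    and "(a, b) \<in> equiv A hull r"
  shows "f a = f b"
proof -
  have "equiv A hull r \<subseteq> {(a, b). a \<in> A \<and> b \<in> A \<and> f a = f b}"
    using assms(1) by (intro hull_minimal equiv_kernel) blast
  then show ?thesis using assms(2) by blast
qed

lemma congruence_kernel:
  assumes "semigrp S"
    and "\<And>a b c d. \<lbrakk>a \<in> carrier S; b \<in> carrier S; c \<in> carrier S; d \<in> carrier S; f a = f b; f c = f d\<rbrakk>
      \<Longrightarrow> f (a \<cdot>\<^bsub>S\<^esub> c) = f (b \<cdot>\<^bsub>S\<^esub> d)"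
  shows "congruence S {(a, b). a \<in> carrier S \<and> b \<in> carrier S \<and> f a = f b}"
  unfolding congruence_def using equiv_kernel assms(2) semigrp.op_closed[OF assms(1)] by auto

lemma congruence_hull_respects:
  assumes "semigrp S"
    and "\<And>a b c d. \<lbrakk>a \<in> carrier S; b \<in> carrier S; c \<in> carrier S; d \<in> carrier S; f a = f b; f c = f d\<rbrakk>
      \<Longrightarrow> f (a \<cdot>\<^bsub>S\<^esub> c) = f (b \<cdot>\<^bsub>S\<^esub> d)"
    and "\<And>a b. (a, b) \<in> r \<Longrightarrow> a \<in> carrier S \<and> b \<in> carrier S \<and> f a = f b"
    and "(a, b) \<in> congruence S hull r"
  shows "f a = f b"
proof -
  have "congruence S hull r \<subseteq> {(a, b). a \<in> carrier S \<and> b \<in> carrier S \<and> f a = f b}"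
    using assms(3) by (intro hull_minimal congruence_kernel assms(1,2)) blast+
  then show ?thesis using assms(4) by blast
qed

lemma congruence_hull:
  assumes "semigrp S" "r \<subseteq> carrier S \<times> carrier S"
  shows "congruence S (congruence S hull r)"
proof -
  let ?H = "congruence S hull r"
  have "?H \<subseteq> carrier S \<times> carrier S"
    using congruence_kernel[OF assms(1), of "\<lambda>_. ()"] assms(2)
    by (intro hull_minimal) (auto simp: Sigma_def)
  moreover have "refl_on (carrier S) ?H"
    by (auto simp: hull_def refl_on_def congruence_def equiv_def)
  moreover have "sym ?H"
    unfolding hull_def congruence_def equiv_def by (rule symI) (blast dest: symD)
  moreover have "trans ?H"
    unfolding hull_def congruence_def equiv_def by (rule transI) (blast dest: transD)
  moreover have "(a \<cdot>\<^bsub>S\<^esub> c, b \<cdot>\<^bsub>S\<^esub> d) \<in> ?H" if "(a, b) \<in> ?H" "(c, d) \<in> ?H" for a b c d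
    using that unfolding hull_def congruence_def by blast
  ultimately show ?thesis by (auto simp: congruence_def intro: equivI)
qed

lemma quotient_op_class:
  assumes "congruence S r" "a \<in> carrier S" "b \<in> carrier S"
  shows "r `` {a} \<cdot>\<^bsub>quotient_semigrp S r\<^esub> r `` {b} = r `` {a \<cdot>\<^bsub>S\<^esub> b}"
proof -
  have eq: "equiv (carrier S) r" using assms(1) by (simp add: congruence_def)
  have "congruent2 r r (\<lambda>a b. r `` {a \<cdot>\<^bsub>S\<^esub> b})"
    using assms(1) unfolding congruent2_def
    by (auto simp: congruence_def intro!: equiv_class_eq[OF eq])
  from UN_equiv_class2[OF eq eq this assms(2,3)] show ?thesis
    by (simp add: quotient_semigrp_def)
qed

lemma quotient_carrier: "carrier (quotient_semigrp S r) = carrier S // r"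
  by (simp add: quotient_semigrp_def)

lemma semigrp_quotient:
  assumes S: "semigrp S" and r: "congruence S r"
  shows "semigrp (quotient_semigrp S r)"
proof
  note [simp] = quotient_carrier quotient_op_class[OF r] semigrp.op_closed[OF S]
  fix x y z
  assume "x \<in> carrier (quotient_semigrp S r)" "y \<in> carrier (quotient_semigrp S r)"
  then show "x \<cdot>\<^bsub>quotient_semigrp S r\<^esub> y \<in> carrier (quotient_semigrp S r)"
    by (auto elim!: quotientE intro!: quotientI)
next
  note [simp] = quotient_carrier quotient_op_class[OF r] semigrp.op_closed[OF S]
  fix x y z
  assume "x \<in> carrier (quotient_semigrp S r)" "y \<in> carrier (quotient_semigrp S r)"
    "z \<in> carrier (quotient_semigrp S r)"
  then show "(x \<cdot>\<^bsub>quotient_semigrp S r\<^esub> y) \<cdot>\<^bsub>quotient_semigrp S r\<^esub> z =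
    x \<cdot>\<^bsub>quotient_semigrp S r\<^esub> (y \<cdot>\<^bsub>quotient_semigrp S r\<^esub> z)"
    by (auto elim!: quotientE simp: semigrp.op_assoc[OF S])
qed

section \<open>Free semigroups and evaluation of words\<close>

lemma semigrp_free: "semigrp (free_semigrp A)"
  by unfold_locales (auto simp: free_semigrp_def)

text \<open>A semigroup need not have a unit, so the recursion bottoms out at single letters and the
  empty word only gets a filler value.\<close>

fun word_prod :: "'b magma \<Rightarrow> ('a \<Rightarrow> 'b) \<Rightarrow> 'a list \<Rightarrow> 'b" where
  "word_prod S f [] = undefined"
| "word_prod S f [c] = f c"
| "word_prod S f (c # d # w) = f c \<cdot>\<^bsub>S\<^esub> word_prod S f (d # w)"

lemma word_prod_closed:
  assumes "semigrp S" "f \<in> A \<rightarrow> carrier S" "w \<in> lists A" "w \<noteq> []"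
  shows "word_prod S f w \<in> carrier S"
  using assms by (induction S f w rule: word_prod.induct) (auto intro!: semigrp.op_closed)

lemma word_prod_append:
  assumes S: "semigrp S" and f: "f \<in> A \<rightarrow> carrier S"
    and u: "u \<in> lists A" "u \<noteq> []" and v: "v \<in> lists A" "v \<noteq> []"
  shows "word_prod S f (u @ v) = word_prod S f u \<cdot>\<^bsub>S\<^esub> word_prod S f v"
  using u(2,1)
proof (induction u rule: list_nonempty_induct)
  case (single c)
  then show ?case using v by (cases v) auto
next
  case (cons c u)
  then have IH: "word_prod S f (u @ v) = word_prod S f u \<cdot>\<^bsub>S\<^esub> word_prod S f v" and c: "c \<in> A" and u: "u \<in> lists A"
    by auto
  obtain d u' where d: "u = d # u'" using cons.hyps by (cases u) auto
  have "word_prod S f u \<in> carrier S" "word_prod S f v \<in> carrier S" "f c \<in> carrier S"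
    using cons.hyps u v c f by (auto intro!: word_prod_closed[OF S f])
  then show ?case using IH unfolding d by (simp add: semigrp.op_assoc[OF S])
qed


section \<open>The universal property over an arbitrary monoid\<close>

locale partial_action_on_semigrp =
  fixes M :: "'m monoid" and X :: "'x magma"
    and D :: "'m \<Rightarrow> 'x set" and \<alpha> :: "'m \<Rightarrow> 'x \<Rightarrow> 'x"
  assumes monoid: "monoid M" and semigrp: "semigrp X"
    and action: "strong_partial_action M X D \<alpha>"
begin

abbreviation "pairs \<equiv> carrier M \<times> carrier X"
abbreviation "arrow \<equiv> XM_arrow M X D \<alpha>"
abbreviation "cls \<equiv> XM_class M X D \<alpha>"
abbreviation "letters \<equiv> XM M X D \<alpha>"
abbreviation "F \<equiv> free_semigrp letters"
abbreviation "R \<equiv> R_cong M X D \<alpha>"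
abbreviation "Q \<equiv> XM_semigrp M X D \<alpha>"
abbreviation "act \<equiv> XM_act M X D \<alpha>"
abbreviation "\<beta> \<equiv> beta_bar M X D \<alpha>"
abbreviation "\<iota> \<equiv> iota_bar M X D \<alpha>"

lemmas mult_closed [simp, intro] = monoid.m_closed[OF monoid]
  and one_closed [simp, intro] = monoid.one_closed[OF monoid]
  and X_closed [simp, intro] = semigrp.op_closed[OF semigrp]
  and X_assoc = semigrp.op_assoc[OF semigrp]

lemma D_subset: "m \<in> carrier M \<Longrightarrow> x \<in> D m \<Longrightarrow> x \<in> carrier X"
  and action_closed: "m \<in> carrier M \<Longrightarrow> x \<in> D m \<Longrightarrow> \<alpha> m x \<in> carrier X"
  and D_one: "D \<one>\<^bsub>M\<^esub> = carrier X"
  and action_one: "x \<in> carrier X \<Longrightarrow> \<alpha> \<one>\<^bsub>M\<^esub> x = x"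
  and action_D_iff: "m \<in> carrier M \<Longrightarrow> n \<in> carrier M \<Longrightarrow> x \<in> D m \<Longrightarrow>
    \<alpha> m x \<in> D n \<longleftrightarrow> x \<in> D (n \<otimes>\<^bsub>M\<^esub> m)"
  and action_mult: "m \<in> carrier M \<Longrightarrow> n \<in> carrier M \<Longrightarrow> x \<in> D m \<Longrightarrow> \<alpha> m x \<in> D n \<Longrightarrow>
    \<alpha> n (\<alpha> m x) = \<alpha> (n \<otimes>\<^bsub>M\<^esub> m) x"
  and action_hom: "m \<in> carrier M \<Longrightarrow> x \<in> D m \<Longrightarrow> y \<in> D m \<Longrightarrow>
    \<alpha> m (x \<cdot>\<^bsub>X\<^esub> y) = \<alpha> m x \<cdot>\<^bsub>X\<^esub> \<alpha> m y"
  using action unfolding strong_partial_action_def strong_partial_action_on_def semigrp_hom_def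
  by (auto simp: set_eq_iff) blast+

section \<open>The set of letters \<open>[m, x]\<close> and maps out of it\<close>

lemma equiv_XM_rel: "equiv pairs (XM_rel M X D \<alpha>)"
  unfolding XM_rel_def by (rule equiv_hull) (auto simp: XM_arrow_def)

lemma letters_eq: "letters = (\<lambda>(m, x). cls m x) ` pairs"
  by (auto simp: XM_def XM_class_def quotient_def)

lemma lettersE:
  assumes "c \<in> letters"
  obtains m x where "c = cls m x" "m \<in> carrier M" "x \<in> carrier X"
  using assms by (auto simp: letters_eq)

lemma cls_in_letters [simp, intro]: "m \<in> carrier M \<Longrightarrow> x \<in> carrier X \<Longrightarrow> cls m x \<in> letters"
  by (auto simp: letters_eq)

lemma cls_respects:
  assumes "\<And>n k x. \<lbrakk>n \<in> carrier M; k \<in> carrier M; x \<in> D k\<rbrakk> \<Longrightarrow> f (n \<otimes>\<^bsub>M\<^esub> k, x) = f (n, \<alpha> k x)"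
    and "(p, q) \<in> XM_rel M X D \<alpha>"
  shows "f p = f q"
  using assms(2) unfolding XM_rel_def
  by (rule equiv_hull_respects[rotated]) (auto simp: XM_arrow_def assms(1))

lemma cls_mult:
  assumes "n \<in> carrier M" "k \<in> carrier M" "x \<in> D k"
  shows "cls (n \<otimes>\<^bsub>M\<^esub> k) x = cls n (\<alpha> k x)"
proof -
  have "((n \<otimes>\<^bsub>M\<^esub> k, x), (n, \<alpha> k x)) \<in> arrow"
    unfolding XM_arrow_def using assms D_subset action_closed by auto
  then have "((n \<otimes>\<^bsub>M\<^esub> k, x), (n, \<alpha> k x)) \<in> XM_rel M X D \<alpha>"
    unfolding XM_rel_def by (rule hull_inc)
  then show ?thesis
    unfolding XM_class_def by (rule equiv_class_eq[OF equiv_XM_rel])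
qed

text \<open>Meaningful only if \<open>f\<close> is constant along arrows.\<close>

definition descend :: "('m \<times> 'x \<Rightarrow> 'c) \<Rightarrow> ('m \<times> 'x) set \<Rightarrow> 'c" where
  "descend f c = f (SOME p. p \<in> c)"

lemma descend_cls:
  assumes "\<And>n k x. \<lbrakk>n \<in> carrier M; k \<in> carrier M; x \<in> D k\<rbrakk> \<Longrightarrow> f (n \<otimes>\<^bsub>M\<^esub> k, x) = f (n, \<alpha> k x)"
    and "m \<in> carrier M" "x \<in> carrier X"
  shows "descend f (cls m x) = f (m, x)"
proof -
  have "(m, x) \<in> cls m x"
    using assms(2,3) equiv_class_self[OF equiv_XM_rel] by (auto simp: XM_class_def)
  then have "(SOME p. p \<in> cls m x) \<in> cls m x" by (rule someI)
  then have "((m, x), SOME p. p \<in> cls m x) \<in> XM_rel M X D \<alpha>" by (simp add: XM_class_def)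
  from cls_respects[of f, OF assms(1) this] show ?thesis by (simp add: descend_def)
qed

text \<open>By associativity, left multiplication of the labels by \<open>n\<close> carries arrows
  to arrows, so the union defining \<open>XM_act\<close> runs over equal classes.\<close>

lemma act_cls:
  assumes n: "n \<in> carrier M" and "m \<in> carrier M" "x \<in> carrier X"
  shows "act n (cls m x) = cls (n \<otimes>\<^bsub>M\<^esub> m) x"
proof -
  let ?f = "\<lambda>(m, x). cls (n \<otimes>\<^bsub>M\<^esub> m) x"
  have "congruent (XM_rel M X D \<alpha>) ?f"
  proof (rule congruentI)
    fix p q assume "(p, q) \<in> XM_rel M X D \<alpha>"
    then show "?f p = ?f q"
      using n by (rule_tac cls_respects[of ?f])
        (auto simp: cls_mult simp flip: monoid.m_assoc[OF monoid])
  qed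
  from UN_equiv_class[OF equiv_XM_rel this, of "(m, x)"] show ?thesis
    using assms by (simp add: XM_act_def XM_class_def)
qed

lemma act_in_letters: "n \<in> carrier M \<Longrightarrow> c \<in> letters \<Longrightarrow> act n c \<in> letters"
  by (auto simp: act_cls elim!: lettersE)

section \<open>The quotient semigroup of words and the global action on it\<close>

lemma F_carrier: "w \<in> carrier F \<longleftrightarrow> w \<in> lists letters \<and> w \<noteq> []"
  by (auto simp: free_semigrp_def)

lemma F_op [simp]: "u \<cdot>\<^bsub>F\<^esub> v = u @ v"
  by (simp add: free_semigrp_def)

lemma congruence_R: "congruence F R"
  unfolding R_cong_def
  by (rule congruence_hull[OF semigrp_free]) (auto simp: F_carrier)

lemma equiv_R: "equiv (carrier F) R"
  using congruence_R by (simp add: congruence_def)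

lemma R_generator:
  "\<lbrakk>m \<in> carrier M; x \<in> carrier X; y \<in> carrier X\<rbrakk> \<Longrightarrow> ([cls m x, cls m y], [cls m (x \<cdot>\<^bsub>X\<^esub> y)]) \<in> R"
  unfolding R_cong_def by (rule hull_inc) blast

text \<open>Compatibility is asked of the kernel of \<open>f\<close> only, so the values of
  \<open>f\<close> need no multiplication. The lemma is applied to congruence classes, to evaluation
  in a semigroup and to sets of equivalent words.\<close>

lemma R_respects:
  assumes "\<And>a b c d. \<lbrakk>a \<in> carrier F; b \<in> carrier F; c \<in> carrier F; d \<in> carrier F; f a = f b; f c = f d\<rbrakk>
      \<Longrightarrow> f (a @ c) = f (b @ d)"
    and "\<And>m x y. \<lbrakk>m \<in> carrier M; x \<in> carrier X; y \<in> carrier X\<rbrakk> \<Longrightarrow>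
      f [cls m x, cls m y] = f [cls m (x \<cdot>\<^bsub>X\<^esub> y)]"
    and "(u, v) \<in> R"
  shows "f u = f v"
proof (rule congruence_hull_respects[OF semigrp_free])
  show "(u, v) \<in> congruence F hull
      {([cls m x, cls m y], [cls m (x \<cdot>\<^bsub>X\<^esub> y)]) | m x y. m \<in> carrier M \<and> x \<in> carrier X \<and> y \<in> carrier X}"
    using assms(3) by (simp only: R_cong_def)
  show "f (a \<cdot>\<^bsub>F\<^esub> c) = f (b \<cdot>\<^bsub>F\<^esub> d)"
    if "a \<in> carrier F" "b \<in> carrier F" "c \<in> carrier F" "d \<in> carrier F" "f a = f b" "f c = f d" for a b c d
    using assms(1)[OF that] by simp
qed (use assms(2) in \<open>force simp: F_carrier\<close>)

abbreviation "wcls w \<equiv> R `` {w}"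

lemma Q_carrier: "carrier Q = wcls ` carrier F"
  by (auto simp: XM_semigrp_def quotient_carrier quotient_def)

lemma wcls_closed [simp, intro]: "w \<in> carrier F \<Longrightarrow> wcls w \<in> carrier Q"
  by (simp add: Q_carrier)

lemma Q_op: "u \<in> carrier F \<Longrightarrow> v \<in> carrier F \<Longrightarrow> wcls u \<cdot>\<^bsub>Q\<^esub> wcls v = wcls (u @ v)"
  using quotient_op_class[OF congruence_R] by (simp add: XM_semigrp_def)

lemma semigrp_Q: "semigrp Q"
  unfolding XM_semigrp_def by (rule semigrp_quotient[OF semigrp_free congruence_R])

lemma append_F [simp, intro]: "u \<in> carrier F \<Longrightarrow> v \<in> carrier F \<Longrightarrow> u @ v \<in> carrier F"
  by (auto simp: F_carrier)

lemma singleton_F [simp, intro]: "m \<in> carrier M \<Longrightarrow> x \<in> carrier X \<Longrightarrow> [cls m x] \<in> carrier F"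
  by (auto simp: F_carrier)

lemma map_act_F [simp, intro]: "n \<in> carrier M \<Longrightarrow> w \<in> carrier F \<Longrightarrow> map (act n) w \<in> carrier F"
  by (auto simp: F_carrier act_in_letters)

lemma wcls_mult:
  "\<lbrakk>m \<in> carrier M; x \<in> carrier X; y \<in> carrier X\<rbrakk> \<Longrightarrow>
    wcls [cls m x, cls m y] = wcls [cls m (x \<cdot>\<^bsub>X\<^esub> y)]"
  by (rule equiv_class_eq[OF equiv_R R_generator])

text \<open>Acting letterwise by \<open>n\<close> turns the generating pair of \<open>R\<close> for
  \<open>m, x, y\<close> into the one for \<open>nm, x, y\<close>, so the class of the image does
  not depend on the representative.\<close>

lemma beta_wcls:
  assumes n: "n \<in> carrier M" and w: "w \<in> carrier F"
  shows "\<beta> n (wcls w) = wcls (map (act n) w)"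
proof -
  let ?f = "\<lambda>w. wcls (map (act n) w)"
  have "congruent R ?f"
  proof (rule congruentI)
    fix u v assume "(u, v) \<in> R"
    then show "?f u = ?f v"
    proof (rule R_respects[of ?f, rotated -1])
      fix a b c d
      assume "a \<in> carrier F" "b \<in> carrier F" "c \<in> carrier F" "d \<in> carrier F"
        "?f a = ?f b" "?f c = ?f d"
      then show "?f (a @ c) = ?f (b @ d)"
        using n by (simp flip: Q_op)
    qed (use n in \<open>auto simp: act_cls wcls_mult\<close>)
  qed
  from UN_equiv_class[OF equiv_R this w] show ?thesis
    by (simp add: beta_bar_def)
qed

lemma map_act_one: "w \<in> carrier F \<Longrightarrow> map (act \<one>\<^bsub>M\<^esub>) w = w"
  by (rule map_idI) (auto simp: F_carrier act_cls monoid.l_one[OF monoid] elim!: lettersE dest!: in_listsD)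

lemma map_act_mult:
  "\<lbrakk>m \<in> carrier M; n \<in> carrier M; w \<in> carrier F\<rbrakk> \<Longrightarrow>
    map (act n) (map (act m) w) = map (act (n \<otimes>\<^bsub>M\<^esub> m)) w"
  by (auto simp: F_carrier act_cls monoid.m_assoc[OF monoid] elim!: lettersE)

lemma global_action_beta: "global_action M Q \<beta>"
proof -
  \<comment> \<open>A global action is by definition a strong partial action with full domains; the
    trivial record update matches the restricted semigroup occurring there.\<close>
  have "\<beta> m \<in> semigrp_hom (Q\<lparr>carrier := carrier Q\<rparr>) Q" if "m \<in> carrier M" for m
    using that by (auto simp: semigrp_hom_def Q_carrier Q_op beta_wcls)
  then show ?thesis
    unfolding global_action_def strong_partial_action_def strong_partial_action_on_def subsemigrp_def
    by (auto simp: semigrp.op_closed[OF semigrp_Q])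
      (auto simp: Q_carrier beta_wcls map_act_one map_act_mult simp del: map_map)
qed

lemma iota_hom: "\<iota> \<in> semigrp_hom X Q"
  by (auto simp: semigrp_hom_def iota_bar_def Q_op wcls_mult)

text \<open>Because \<open>me = m\<close>, every one-letter class is a translate of a point of the
  image of \<open>\<iota>\<close>. Uniqueness of extensions and the reduction to separation both
  rest on this.\<close>

lemma beta_iota:
  "m \<in> carrier M \<Longrightarrow> x \<in> carrier X \<Longrightarrow> \<beta> m (\<iota> x) = wcls [cls m x]"
  by (simp add: iota_bar_def beta_wcls act_cls monoid.r_one[OF monoid])

lemma action_morphism_iota: "action_morphism M X D \<alpha> Q \<beta> \<iota>"
  unfolding action_morphism_def
proof (intro conjI iota_hom ballI)
  fix m x assume "m \<in> carrier M" "x \<in> D m"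
  then show "\<beta> m (\<iota> x) = \<iota> (\<alpha> m x)"
    \<comment> \<open>The arrow from \<open>(em, x)\<close> to
      \<open>(e, \<alpha> m x)\<close>.\<close>
    using cls_mult[of "\<one>\<^bsub>M\<^esub>" m x] monoid.l_one[OF monoid]
    by (simp add: beta_iota D_subset) (simp add: iota_bar_def)
qed

section \<open>Uniqueness and existence of the induced morphism\<close>

lemma F_induct [consumes 1, case_names single append]:
  assumes "w \<in> carrier F"
    and "\<And>m x. \<lbrakk>m \<in> carrier M; x \<in> carrier X\<rbrakk> \<Longrightarrow> P [cls m x]"
    and "\<And>u v. \<lbrakk>u \<in> carrier F; v \<in> carrier F; P u; P v\<rbrakk> \<Longrightarrow> P (u @ v)"
  shows "P w"
proof -
  from assms(1) have "w \<noteq> []" "w \<in> lists letters" by (auto simp: F_carrier)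
  then show ?thesis
  proof (induction w rule: list_nonempty_induct)
    case (single c)
    then show ?case using assms(2) by (auto simp: letters_eq)
  next
    case (cons c w)
    then show ?case using assms(2) assms(3)[of "[c]" w] by (auto simp: F_carrier elim: lettersE)
  qed
qed

text \<open>The translates of the image of \<open>\<iota>\<close> are all the one-letter classes,
  and these generate \<open>Q\<close>.\<close>

lemma morphism_eqI:
  assumes "action_morphism M Q (\<lambda>_. carrier Q) \<beta> Z \<gamma> f" "action_morphism M Q (\<lambda>_. carrier Q) \<beta> Z \<gamma> g"
    and "\<And>x. x \<in> carrier X \<Longrightarrow> f (\<iota> x) = g (\<iota> x)" and "C \<in> carrier Q"
  shows "f C = g C"
proof -
  have hom: "\<lbrakk>A \<in> carrier Q; B \<in> carrier Q\<rbrakk> \<Longrightarrow> f (A \<cdot>\<^bsub>Q\<^esub> B) = f A \<cdot>\<^bsub>Z\<^esub> f B"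
    "\<lbrakk>A \<in> carrier Q; B \<in> carrier Q\<rbrakk> \<Longrightarrow> g (A \<cdot>\<^bsub>Q\<^esub> B) = g A \<cdot>\<^bsub>Z\<^esub> g B" for A B
    using assms(1,2) by (auto simp: action_morphism_def semigrp_hom_def)
  have act: "\<lbrakk>m \<in> carrier M; A \<in> carrier Q\<rbrakk> \<Longrightarrow> f (\<beta> m A) = \<gamma> m (f A)"
    "\<lbrakk>m \<in> carrier M; A \<in> carrier Q\<rbrakk> \<Longrightarrow> g (\<beta> m A) = \<gamma> m (g A)" for m A
    using assms(1,2) by (auto simp: action_morphism_def)
  have iota: "\<iota> x \<in> carrier Q" if "x \<in> carrier X" for x
    using iota_hom that by (auto simp: semigrp_hom_def)
  obtain w where w: "w \<in> carrier F" and C: "C = wcls w" using assms(4) by (auto simp: Q_carrier)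
  from w have "f (wcls w) = g (wcls w)"
  proof (induction w rule: F_induct)
    case (single m x)
    then show ?case using assms(3) act iota by (simp flip: beta_iota)
  next
    case (append u v)
    then show ?case by (simp add: hom flip: Q_op)
  qed
  then show ?thesis by (simp add: C)
qed

lemma extension_exists:
  fixes Z :: "'z magma"
  assumes Z: "semigrp Z" and \<gamma>: "global_action M Z \<gamma>" and \<kappa>: "action_morphism M X D \<alpha> Z \<gamma> \<kappa>"
  obtains f where "action_morphism M Q (\<lambda>_. carrier Q) \<beta> Z \<gamma> f"
    and "\<And>x. x \<in> carrier X \<Longrightarrow> f (\<iota> x) = \<kappa> x"
proof -
  \<comment> \<open>A global action is a partial action too, so the rules for composing and
    multiplying partial maps become available for \<open>\<gamma>\<close>.\<close>
  interpret Z: partial_action_on_semigrp M Z "\<lambda>_. carrier Z" \<gamma>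
    using monoid Z \<gamma> by (intro partial_action_on_semigrp.intro) (auto simp: global_action_def)
  have kc: "\<kappa> x \<in> carrier Z" if "x \<in> carrier X" for x
    using \<kappa> that by (auto simp: action_morphism_def semigrp_hom_def)
  have kh: "\<kappa> (x \<cdot>\<^bsub>X\<^esub> y) = \<kappa> x \<cdot>\<^bsub>Z\<^esub> \<kappa> y" if "x \<in> carrier X" "y \<in> carrier X" for x y
    using \<kappa> that by (auto simp: action_morphism_def semigrp_hom_def)
  have ka: "\<gamma> m (\<kappa> x) = \<kappa> (\<alpha> m x)" if "m \<in> carrier M" "x \<in> D m" for m x
    using \<kappa> that by (auto simp: action_morphism_def)
  define h where "h = descend (\<lambda>(m, x). \<gamma> m (\<kappa> x))"
  have h_cls: "h (cls m x) = \<gamma> m (\<kappa> x)" if "m \<in> carrier M" "x \<in> carrier X" for m x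
    unfolding h_def
  proof (subst descend_cls)
    fix n k x assume *: "n \<in> carrier M" "k \<in> carrier M" "x \<in> D k"
    \<comment> \<open>Constancy along arrows: split \<open>\<gamma>\<close> at \<open>nk\<close>
      into two maps, then move the inner one through \<open>\<kappa>\<close> by
      equivariance.\<close>
    then have "\<gamma> (n \<otimes>\<^bsub>M\<^esub> k) (\<kappa> x) = \<gamma> n (\<gamma> k (\<kappa> x))"
      by (intro Z.action_mult[symmetric]) (auto intro: kc D_subset Z.action_closed)
    then show "(case (n \<otimes>\<^bsub>M\<^esub> k, x) of (m, x) \<Rightarrow> \<gamma> m (\<kappa> x)) = (case (n, \<alpha> k x) of (m, x) \<Rightarrow> \<gamma> m (\<kappa> x))"
      using * by (simp add: ka)
  qed (use that in auto)
  have h: "h \<in> letters \<rightarrow> carrier Z"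
    by (auto elim!: lettersE simp: h_cls intro!: Z.action_closed kc)
  define ev where "ev = word_prod Z h"
  have ev_closed: "ev w \<in> carrier Z" if "w \<in> carrier F" for w
    using that word_prod_closed[OF Z h] by (auto simp: ev_def F_carrier)
  have ev_append: "ev (u @ v) = ev u \<cdot>\<^bsub>Z\<^esub> ev v" if "u \<in> carrier F" "v \<in> carrier F" for u v
    using that word_prod_append[OF Z h] by (auto simp: ev_def F_carrier)
  have ev_single: "ev [cls m x] = \<gamma> m (\<kappa> x)" if "m \<in> carrier M" "x \<in> carrier X" for m x
    using that by (simp add: ev_def h_cls)
  have ev_R: "ev u = ev v" if "(u, v) \<in> R" for u v
    using that
  proof (rule R_respects[of ev, rotated -1])
    fix m x y assume "m \<in> carrier M" "x \<in> carrier X" "y \<in> carrier X"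
    then show "ev [cls m x, cls m y] = ev [cls m (x \<cdot>\<^bsub>X\<^esub> y)]"
      using ev_append[of "[cls m x]" "[cls m y]"]
      by (simp add: ev_single kh kc Z.action_hom)
  qed (simp add: ev_append)
  \<comment> \<open>Any representative serves, because \<open>ev_R\<close> makes \<open>ev\<close>
    constant on classes.\<close>
  define f where "f C = ev (SOME w. w \<in> C)" for C
  have f_wcls: "f (wcls w) = ev w" if "w \<in> carrier F" for w
  proof -
    have "w \<in> wcls w" using that equiv_class_self[OF equiv_R] by auto
    then have "(SOME w'. w' \<in> wcls w) \<in> wcls w" by (rule someI)
    then show ?thesis using ev_R[of w] by (simp add: f_def)
  qed
  have ev_act: "ev (map (act n) w) = \<gamma> n (ev w)" if "n \<in> carrier M" "w \<in> carrier F" for n w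
    using that(2)
  proof (induction w rule: F_induct)
    case (single m x)
    then show ?case
      using that(1) Z.action_mult[of m n "\<kappa> x"] by (simp add: act_cls ev_single kc Z.action_closed)
  next
    case (append u v)
    then show ?case using that(1) by (simp add: ev_append ev_closed Z.action_hom)
  qed
  show thesis
  proof
    show "action_morphism M Q (\<lambda>_. carrier Q) \<beta> Z \<gamma> f"
      by (auto simp: action_morphism_def semigrp_hom_def Q_carrier Q_op f_wcls ev_append
          ev_closed beta_wcls ev_act)
    show "f (\<iota> x) = \<kappa> x" if "x \<in> carrier X" for x
      using that by (simp add: iota_bar_def f_wcls ev_single Z.action_one kc)
  qed
qed

text \<open>Uniqueness is stated among extensional maps, so the extension has to be cut down to the
  carrier; this is harmless since products and the action stay inside it.\<close>

lemma action_morphism_restrict: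
  assumes "action_morphism M Q (\<lambda>_. carrier Q) \<beta> Z \<gamma> f"
  shows "action_morphism M Q (\<lambda>_. carrier Q) \<beta> Z \<gamma> (restrict f (carrier Q))"
proof -
  have "\<beta> m C \<in> carrier Q" if "m \<in> carrier M" "C \<in> carrier Q" for m C
    using that by (auto simp: Q_carrier beta_wcls)
  then show ?thesis
    using assms semigrp.op_closed[OF semigrp_Q] by (auto simp: action_morphism_def semigrp_hom_def)
qed

text \<open>Everything except separation is now available, and by \<open>beta_iota\<close>
  separation is a statement about congruent one-letter words.\<close>

lemma universal_globalizationI:
  assumes sep: "\<And>m x y. \<lbrakk>m \<in> carrier M; x \<in> carrier X; y \<in> carrier X;
      ([cls m x], [cls \<one>\<^bsub>M\<^esub> y]) \<in> R\<rbrakk> \<Longrightarrow> x \<in> D m \<and> \<alpha> m x = y"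
  shows "universal_globalization TYPE('z) M X D \<alpha> Q \<beta> \<iota>"
  unfolding universal_globalization_def
proof (intro conjI allI impI)
  show "globalization M X D \<alpha> Q \<beta> \<iota>"
    unfolding globalization_def
  proof (intro conjI ballI impI semigrp_Q global_action_beta action_morphism_iota)
    fix x y m
    assume *: "x \<in> carrier X" "y \<in> carrier X" "m \<in> carrier M" and "\<beta> m (\<iota> x) = \<iota> y"
    then have "wcls [cls m x] = wcls [cls \<one>\<^bsub>M\<^esub> y]"
      by (simp add: beta_iota) (simp add: iota_bar_def)
    with * have "([cls m x], [cls \<one>\<^bsub>M\<^esub> y]) \<in> R"
      by (intro eq_equiv_class[OF _ equiv_R]) auto
    from sep[OF *(3,1,2) this] show "x \<in> D m" "\<alpha> m x = y" by auto
  qed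
next
  fix Z :: "'z magma" and \<gamma> \<kappa>
  assume "globalization M X D \<alpha> Z \<gamma> \<kappa>"
  then have Z: "semigrp Z" "global_action M Z \<gamma>" "action_morphism M X D \<alpha> Z \<gamma> \<kappa>"
    by (simp_all add: globalization_def)
  obtain f where f: "action_morphism M Q (\<lambda>_. carrier Q) \<beta> Z \<gamma> f"
    and fi: "\<And>x. x \<in> carrier X \<Longrightarrow> f (\<iota> x) = \<kappa> x"
    using extension_exists[OF Z] by blast
  have iota: "\<iota> x \<in> carrier Q" if "x \<in> carrier X" for x
    using iota_hom that by (auto simp: semigrp_hom_def)
  show "\<exists>!\<kappa>'. \<kappa>' \<in> extensional (carrier Q) \<and>
      action_morphism M Q (\<lambda>_. carrier Q) \<beta> Z \<gamma> \<kappa>' \<and> (\<forall>x\<in>carrier X. \<kappa>' (\<iota> x) = \<kappa> x)"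
  proof (rule ex1I[of _ "restrict f (carrier Q)"])
    show "restrict f (carrier Q) \<in> extensional (carrier Q) \<and>
      action_morphism M Q (\<lambda>_. carrier Q) \<beta> Z \<gamma> (restrict f (carrier Q)) \<and>
      (\<forall>x\<in>carrier X. restrict f (carrier Q) (\<iota> x) = \<kappa> x)"
      using action_morphism_restrict[OF f] fi iota by simp
  next
    fix g
    assume g: "g \<in> extensional (carrier Q) \<and> action_morphism M Q (\<lambda>_. carrier Q) \<beta> Z \<gamma> g \<and>
      (\<forall>x\<in>carrier X. g (\<iota> x) = \<kappa> x)"
    show "g = restrict f (carrier Q)"
    proof (rule extensionalityI[of _ "carrier Q"])
      fix C assume "C \<in> carrier Q"
      then show "g C = restrict f (carrier Q) C"
        using morphism_eqI[of Z \<gamma> g f C] g f fi by simp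
    qed (use g in auto)
  qed
qed

end


section \<open>Words under a partial multiplication\<close>

text \<open>One step of the string rewriting system with rules \<open>cd\<close> to \<open>p\<close>
  whenever \<open>P c d p\<close>. A ternary relation allows the multiplication to be partial and, a
  priori, multivalued.\<close>

inductive contract :: "('a \<Rightarrow> 'a \<Rightarrow> 'a \<Rightarrow> bool) \<Rightarrow> 'a list \<Rightarrow> 'a list \<Rightarrow> bool"
  for P :: "'a \<Rightarrow> 'a \<Rightarrow> 'a \<Rightarrow> bool" where
  contractI: "P c d p \<Longrightarrow> contract P (u @ c # d # v) (u @ p # v)"

lemma contract_context: "contract P u v \<Longrightarrow> contract P (a @ u @ b) (a @ v @ b)"
proof (induction rule: contract.induct)
  case (contractI c d p u v)
  then show ?case using contract.contractI[of P c d p "a @ u" "v @ b"] by simp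
qed

lemma equivclp_contract_context:
  "equivclp (contract P) u v \<Longrightarrow> equivclp (contract P) (a @ u @ b) (a @ v @ b)"
proof (induction rule: equivclp_induct)
  case (step v w)
  then show ?case by (blast intro: equivclp_into_equivclp contract_context)
qed simp

lemma equivclp_contract_append:
  assumes "equivclp (contract P) u u'" "equivclp (contract P) v v'"
  shows "equivclp (contract P) (u @ v) (u' @ v')"
  using equivclp_contract_context[OF assms(1), of "[]" v] equivclp_contract_context[OF assms(2), of u' "[]"]
  by (auto intro: equivclp_trans)

text \<open>The word \<open>t\<close> is the offset of the second redex from the first. Equal
  redexes agree by functionality, redexes sharing one letter are joined by associativity, and
  disjoint ones commute.\<close>

lemma contract_diamond_right:
  assumes functional: "\<And>c d p q. \<lbrakk>P c d p; P c d q\<rbrakk> \<Longrightarrow> p = q"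
    and assoc: "\<And>c d f p q. \<lbrakk>P c d p; P d f q\<rbrakk> \<Longrightarrow> \<exists>r. P p f r \<and> P c q r"
    and p: "P c d p" and q: "P c' d' q" and eq: "c # d # v = t @ c' # d' # v'"
  shows "p # v = t @ q # v' \<or> (\<exists>w. contract P (p # v) w \<and> contract P (t @ q # v') w)"
proof -
  \<comment> \<open>Offsets zero, one, and at least two.\<close>
  consider "t = []" | "t = [c]" | t' where "t = c # d # t'"
    using eq by (cases t; cases "tl t") auto
  then show ?thesis
  proof cases
    case 1
    then show ?thesis using eq p q functional by auto
  next
    case 2
    then obtain r where "P p d' r" "P c q r" using eq p q assoc[of c d p d' q] by auto
    then have "contract P ([] @ p # d' # v') ([] @ r # v')" "contract P ([] @ c # q # v') ([] @ r # v')"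
      by (blast intro: contractI)+
    then show ?thesis using 2 eq by auto
  next
    case 3
    then have "contract P ((p # t') @ c' # d' # v') ((p # t') @ q # v')"
      "contract P ([] @ c # d # (t' @ q # v')) ([] @ p # (t' @ q # v'))"
      using p q by (blast intro: contractI)+
    then show ?thesis using 3 eq by auto
  qed
qed

lemma strong_confluentp_contract:
  assumes functional: "\<And>c d p q. \<lbrakk>P c d p; P c d q\<rbrakk> \<Longrightarrow> p = q"
    and assoc: "\<And>c d f p q. \<lbrakk>P c d p; P d f q\<rbrakk> \<Longrightarrow> \<exists>r. P p f r \<and> P c q r"
  shows "strong_confluentp (contract P)"
proof
  fix x y z assume "contract P x y" "contract P x z"
  then obtain c d p u v c' d' q u' v' where
    y: "P c d p" "x = u @ c # d # v" "y = u @ p # v" and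
    z: "P c' d' q" "x = u' @ c' # d' # v'" "z = u' @ q # v'"
    unfolding contract.simps by blast
  have context': "contract P (a @ w) (a @ w')" if "contract P w w'" for a w w'
    using contract_context[OF that, of a "[]"] by simp
  \<comment> \<open>One of the two redexes starts no later than the other, so one left context is a
    prefix of the other and the one-sided lemma applies up to symmetry.\<close>
  from y(2) z(2) consider t where "u' = u @ t" "c # d # v = t @ c' # d' # v'"
    | t where "u = u' @ t" "c' # d' # v' = t @ c # d # v"
    by (auto simp: append_eq_append_conv2)
  then have "y = z \<or> (\<exists>w. contract P y w \<and> contract P z w)"
  proof cases
    case 1
    have "p # v = t @ q # v' \<or> (\<exists>w. contract P (p # v) w \<and> contract P (t @ q # v') w)"
      by (rule contract_diamond_right[of P, OF _ _ y(1) z(1) 1(2)]) (erule (1) functional, erule (1) assoc)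
    then show ?thesis using 1(1) y(3) z(3) context'[of _ _ u] by (metis append.assoc)
  next
    case 2
    have "q # v' = t @ p # v \<or> (\<exists>w. contract P (q # v') w \<and> contract P (t @ p # v) w)"
      by (rule contract_diamond_right[of P, OF _ _ z(1) y(1) 2(2)]) (erule (1) functional, erule (1) assoc)
    then show ?thesis using 2(1) y(3) z(3) context'[of _ _ u'] by (metis append.assoc)
  qed
  then show "\<exists>w. (contract P)\<^sup>*\<^sup>* y w \<and> (contract P)\<^sup>=\<^sup>= z w"
    by blast
qed

lemma contract_singleton: "\<not> contract P [c] v"
  by (auto elim!: contract.cases simp: Cons_eq_append_conv)

text \<open>By confluence the two words have a common reduct, and one-letter words are normal
  forms.\<close>

lemma equivclp_contract_singletons:
  assumes "\<And>c d p q. \<lbrakk>P c d p; P c d q\<rbrakk> \<Longrightarrow> p = q"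
    and "\<And>c d f p q. \<lbrakk>P c d p; P d f q\<rbrakk> \<Longrightarrow> \<exists>r. P p f r \<and> P c q r"
    and "equivclp (contract P) [c] [d]"
  shows "c = d"
proof -
  have "semiconfluentp (contract P)"
    using strong_confluentp_contract[of P, OF assms(1,2)] by (rule strong_confluentp_into_semiconfluentp)
  from semiconfluentp_equivclp[OF this] assms(3)
  obtain w where "(contract P)\<^sup>*\<^sup>* [c] w" "(contract P)\<^sup>*\<^sup>* [d] w"
    by (auto simp: rtranclp_conversep)
  then show ?thesis by (metis converse_rtranclpE contract_singleton list.inject)
qed


section \<open>Separation over a group with zero\<close>

locale group_zero_action =
  fixes G :: "('g, 'b) monoid_scheme" and X :: "'x magma"
    and D :: "'g option \<Rightarrow> 'x set" and \<alpha> :: "'g option \<Rightarrow> 'x \<Rightarrow> 'x"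
  assumes group: "group G" and semigrp: "semigrp X"
    and action: "strong_partial_action (adjoin_zero G) X D \<alpha>"
    and D_ideal: "\<And>m. m \<in> carrier (adjoin_zero G) \<Longrightarrow> semigrp_ideal (D m) X"
    and im_ideal: "\<And>m. m \<in> carrier (adjoin_zero G) \<Longrightarrow> semigrp_ideal (\<alpha> m ` D m) X"
    and LC1: "\<And>g x y z. \<lbrakk>g \<in> carrier G; x \<in> carrier X; y \<in> D (Some g); z \<in> carrier X\<rbrakk> \<Longrightarrow>
       \<alpha> (Some (inv\<^bsub>G\<^esub> g)) (\<alpha> (Some g) (x \<cdot>\<^bsub>X\<^esub> y) \<cdot>\<^bsub>X\<^esub> z) =
       x \<cdot>\<^bsub>X\<^esub> \<alpha> (Some (inv\<^bsub>G\<^esub> g)) (\<alpha> (Some g) y \<cdot>\<^bsub>X\<^esub> z)"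
    and LC2: "\<And>m x y z w. \<lbrakk>m \<in> carrier (adjoin_zero G); y \<in> D m;
         x \<in> carrier (adjoin_one X); z \<in> carrier (adjoin_one X);
         x \<cdot>\<^bsub>adjoin_one X\<^esub> Some y \<cdot>\<^bsub>adjoin_one X\<^esub> z = Some w; w \<in> D None\<rbrakk> \<Longrightarrow>
       \<exists>w'. x \<cdot>\<^bsub>adjoin_one X\<^esub> Some (\<alpha> m y) \<cdot>\<^bsub>adjoin_one X\<^esub> z = Some w' \<and>
            w' \<in> D None \<and> \<alpha> None w = \<alpha> None w'"

lemma monoid_adjoin_zero: "monoid G \<Longrightarrow> monoid (adjoin_zero G)"
  by (unfold_locales)
    (auto simp: adjoin_zero_def monoid.m_assoc monoid.l_one monoid.r_one
      intro: monoid.m_closed monoid.one_closed split: option.splits)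

lemma semigrp_adjoin_one: "semigrp X \<Longrightarrow> semigrp (adjoin_one X)"
  by unfold_locales
    (auto simp: adjoin_one_def semigrp.op_closed semigrp.op_assoc split: option.splits)

sublocale group_zero_action \<subseteq> partial_action_on_semigrp "adjoin_zero G" X D \<alpha>
  using monoid_adjoin_zero[OF group.is_monoid[OF group]] semigrp action
  by (rule partial_action_on_semigrp.intro)

context group_zero_action
begin

abbreviation "X1 \<equiv> adjoin_one X"

lemma adjoin_zero_simps [simp]:
  "None \<in> carrier (adjoin_zero G)"
  "Some g \<in> carrier (adjoin_zero G) \<longleftrightarrow> g \<in> carrier G"
  "Some g \<otimes>\<^bsub>adjoin_zero G\<^esub> Some h = Some (g \<otimes>\<^bsub>G\<^esub> h)"
  "None \<otimes>\<^bsub>adjoin_zero G\<^esub> m = None"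
  "m \<otimes>\<^bsub>adjoin_zero G\<^esub> None = None"
  "\<one>\<^bsub>adjoin_zero G\<^esub> = Some \<one>\<^bsub>G\<^esub>"
  by (auto simp: adjoin_zero_def split: option.splits)

lemma adjoin_one_simps [simp]:
  "None \<in> carrier X1" "Some x \<in> carrier X1 \<longleftrightarrow> x \<in> carrier X"
  "None \<cdot>\<^bsub>X1\<^esub> a = a" "a \<cdot>\<^bsub>X1\<^esub> None = a"
  "Some x \<cdot>\<^bsub>X1\<^esub> Some y = Some (x \<cdot>\<^bsub>X\<^esub> y)"
  by (auto simp: adjoin_one_def split: option.splits)

lemmas X1_closed [simp, intro] = semigrp.op_closed[OF semigrp_adjoin_one[OF semigrp]]
  and X1_assoc = semigrp.op_assoc[OF semigrp_adjoin_one[OF semigrp]]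

section \<open>The ideal of values of \<open>\<alpha> None\<close> and the invertible maps\<close>

lemma D_mult:
  "\<lbrakk>m \<in> carrier (adjoin_zero G); x \<in> D m; y \<in> carrier X\<rbrakk> \<Longrightarrow> x \<cdot>\<^bsub>X\<^esub> y \<in> D m"
  "\<lbrakk>m \<in> carrier (adjoin_zero G); x \<in> D m; y \<in> carrier X\<rbrakk> \<Longrightarrow> y \<cdot>\<^bsub>X\<^esub> x \<in> D m"
  using D_ideal[of m] by (auto simp: semigrp_ideal_def)

abbreviation "I \<equiv> \<alpha> None ` D None"

lemma I_mult:
  "\<lbrakk>x \<in> I; y \<in> carrier X\<rbrakk> \<Longrightarrow> x \<cdot>\<^bsub>X\<^esub> y \<in> I"
  "\<lbrakk>x \<in> I; y \<in> carrier X\<rbrakk> \<Longrightarrow> y \<cdot>\<^bsub>X\<^esub> x \<in> I"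
  using im_ideal[of None] unfolding semigrp_ideal_def by auto

text \<open>As \<open>m0 = 0\<close>, a value of \<open>\<alpha> None\<close> lies in
  \<open>D m\<close> exactly when its argument lies in \<open>D None\<close>.\<close>

lemma I_D: "\<lbrakk>m \<in> carrier (adjoin_zero G); x \<in> I\<rbrakk> \<Longrightarrow> x \<in> D m"
  using action_D_iff[of None m] by auto

text \<open>Composing \<open>\<alpha> m\<close> after \<open>\<alpha> None\<close> gives the map at
  \<open>m0 = 0\<close>, that is, \<open>\<alpha> None\<close> again.\<close>

lemma I_fixed: "\<lbrakk>m \<in> carrier (adjoin_zero G); x \<in> I\<rbrakk> \<Longrightarrow> \<alpha> m x = x"
  using action_mult[of None m] I_D[of m] by auto

lemma D_inv:
  "\<lbrakk>g \<in> carrier G; x \<in> D (Some g)\<rbrakk> \<Longrightarrow> \<alpha> (Some g) x \<in> D (Some (inv\<^bsub>G\<^esub> g))"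
  using action_D_iff[of "Some g" "Some (inv\<^bsub>G\<^esub> g)" x] D_one D_subset[of "Some g" x]
  by (simp add: group.inv_closed[OF group] group.l_inv[OF group])

lemma action_inv:
  "\<lbrakk>g \<in> carrier G; x \<in> D (Some g)\<rbrakk> \<Longrightarrow> \<alpha> (Some (inv\<^bsub>G\<^esub> g)) (\<alpha> (Some g) x) = x"
  using action_mult[of "Some g" "Some (inv\<^bsub>G\<^esub> g)" x] D_inv[of g x] action_one D_subset[of "Some g" x]
  by (simp add: group.inv_closed[OF group] group.l_inv[OF group])

lemma action_I_iff:
  assumes "g \<in> carrier G" "x \<in> D (Some g)"
  shows "\<alpha> (Some g) x \<in> I \<longleftrightarrow> x \<in> I"
proof
  assume "\<alpha> (Some g) x \<in> I"
  then have "\<alpha> (Some (inv\<^bsub>G\<^esub> g)) (\<alpha> (Some g) x) \<in> I"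
    using I_fixed[of "Some (inv\<^bsub>G\<^esub> g)"] assms(1) group.inv_closed[OF group] by simp
  then show "x \<in> I" by (simp only: action_inv[OF assms])
next
  assume "x \<in> I"
  then show "\<alpha> (Some g) x \<in> I" using I_fixed[of "Some g" x] assms(1) by simp
qed

section \<open>Traces: the syntactic congruence\<close>

text \<open>Equality of traces is the syntactic congruence of \<open>\<alpha>\<^sub>0\<close>; (LC2) is one half of the
  invariance \<open>trace (\<alpha>\<^sub>m(x)) = trace x\<close>.\<close>

definition trace :: "'x \<Rightarrow> ('x option \<times> 'x option \<times> 'x) set" where
  "trace x = {(a, b, \<alpha> None w) | a b w. a \<in> carrier X1 \<and> b \<in> carrier X1 \<and> w \<in> D None \<and>
     a \<cdot>\<^bsub>X1\<^esub> Some x \<cdot>\<^bsub>X1\<^esub> b = Some w}"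

lemma trace_one: "(None, None, v) \<in> trace x \<longleftrightarrow> x \<in> D None \<and> v = \<alpha> None x"
  by (auto simp: trace_def)

text \<open>The factor \<open>z\<close> is absorbed into the right context. Membership of
  \<open>b\<close> is kept as a separate conjunct because it does not follow from membership of the
  product.\<close>

lemma trace_mult_right:
  "\<lbrakk>x \<in> carrier X; z \<in> carrier X\<rbrakk> \<Longrightarrow>
    (a, b, v) \<in> trace (x \<cdot>\<^bsub>X\<^esub> z) \<longleftrightarrow> b \<in> carrier X1 \<and> (a, Some z \<cdot>\<^bsub>X1\<^esub> b, v) \<in> trace x"
  by (auto simp: trace_def X1_assoc simp flip: adjoin_one_simps(5))

lemma trace_mult_left:
  "\<lbrakk>x \<in> carrier X; z \<in> carrier X\<rbrakk> \<Longrightarrow>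
    (a, b, v) \<in> trace (z \<cdot>\<^bsub>X\<^esub> x) \<longleftrightarrow> a \<in> carrier X1 \<and> (a \<cdot>\<^bsub>X1\<^esub> Some z, b, v) \<in> trace x"
  by (auto simp: trace_def X1_assoc simp flip: adjoin_one_simps(5))

lemma trace_mult:
  assumes "x \<in> carrier X" "x' \<in> carrier X" "y \<in> carrier X" "y' \<in> carrier X"
    and "trace x = trace x'" "trace y = trace y'"
  shows "trace (x \<cdot>\<^bsub>X\<^esub> y) = trace (x' \<cdot>\<^bsub>X\<^esub> y')"
proof -
  have "trace (x \<cdot>\<^bsub>X\<^esub> y) = trace (x' \<cdot>\<^bsub>X\<^esub> y)"
    using assms by (auto simp: trace_mult_right)
  also have "\<dots> = trace (x' \<cdot>\<^bsub>X\<^esub> y')"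
    using assms by (auto simp: trace_mult_left)
  finally show ?thesis .
qed

lemma trace_action_mono:
  assumes "m \<in> carrier (adjoin_zero G)" "x \<in> D m"
  shows "trace x \<subseteq> trace (\<alpha> m x)"
  using LC2[OF assms] unfolding trace_def by fastforce

text \<open>For the reverse inclusion at a group element, the inverse element is applied to
  \<open>\<alpha> m x\<close>. At zero, \<open>D None\<close> is an ideal, so every context of
  \<open>x\<close> already contributes an entry to \<open>trace x\<close>, and each context has only
  one value.\<close>

lemma trace_action:
  assumes m: "m \<in> carrier (adjoin_zero G)" and x: "x \<in> D m"
  shows "trace (\<alpha> m x) = trace x"
proof (rule antisym[OF _ trace_action_mono[OF assms]])
  show "trace (\<alpha> m x) \<subseteq> trace x"
  proof (cases m)
    case None
    show ?thesis
    proof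
      fix t assume "t \<in> trace (\<alpha> m x)"
      then obtain a b v where t: "t = (a, b, v)" "(a, b, v) \<in> trace (\<alpha> m x)"
        and ab: "a \<in> carrier X1" "b \<in> carrier X1"
        by (auto simp: trace_def)
      \<comment> \<open>Here \<open>x\<close> lies in the ideal \<open>D None\<close>, hence so does
        its product with any context.\<close>
      obtain w where w: "a \<cdot>\<^bsub>X1\<^esub> Some x \<cdot>\<^bsub>X1\<^esub> b = Some w" "w \<in> D None"
        using ab x None D_mult[of None] D_subset[of None x]
        by (cases a; cases b) auto
      then have "(a, b, \<alpha> None w) \<in> trace x" using ab by (auto simp: trace_def)
      moreover from this have "(a, b, \<alpha> None w) \<in> trace (\<alpha> m x)"
        using trace_action_mono[OF assms] by blast
      \<comment> \<open>Both values belong to the same context \<open>(a, b)\<close> of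
        \<open>\<alpha> m x\<close>.\<close>
      with t have "v = \<alpha> None w" by (auto simp: trace_def)
      ultimately show "t \<in> trace x" by (simp add: t)
    qed
  next
    case (Some g)
    then show ?thesis
      using trace_action_mono[of "Some (inv\<^bsub>G\<^esub> g)" "\<alpha> m x"] m x D_inv[of g x] action_inv[of g x]
      by (simp add: group.inv_closed[OF group])
  qed
qed

section \<open>Orbits and the collapsed set of letters\<close>

text \<open>A canonical form of \<open>[g, x]\<close> for labels in the group: writing
  \<open>g\<close> as \<open>h\<close> times \<open>inv h\<close> times \<open>g\<close>, it records
  for each \<open>h\<close> the point \<open>y\<close> with \<open>[g, x] = [h, y]\<close> reached
  by the corresponding arrow, if there is one.\<close>

definition orbit :: "'g \<Rightarrow> 'x \<Rightarrow> 'g \<Rightarrow> 'x option" where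
  "orbit g x h = (if h \<in> carrier G \<and> x \<in> D (Some (inv\<^bsub>G\<^esub> h \<otimes>\<^bsub>G\<^esub> g))
     then Some (\<alpha> (Some (inv\<^bsub>G\<^esub> h \<otimes>\<^bsub>G\<^esub> g)) x) else None)"

lemma orbit_eq_iff:
  assumes g: "g \<in> carrier G" and h: "h \<in> carrier G" and "x \<in> carrier X" and y: "y \<in> carrier X"
  defines "k \<equiv> inv\<^bsub>G\<^esub> h \<otimes>\<^bsub>G\<^esub> g"
  shows "orbit g x = orbit h y \<longleftrightarrow> x \<in> D (Some k) \<and> \<alpha> (Some k) x = y"
proof
  interpret group G by (rule group)
  assume "orbit g x = orbit h y"
  \<comment> \<open>At its own label \<open>h\<close>, the orbit of \<open>y\<close> takes the value
    \<open>Some y\<close>, because \<open>D\<close> at the identity is all of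
    \<open>X\<close>.\<close>
  then have "orbit g x h = orbit h y h" by simp
  then show "x \<in> D (Some k) \<and> \<alpha> (Some k) x = y"
    using g h y D_one action_one by (auto simp: orbit_def k_def split: if_splits)
next
  interpret group G by (rule group)
  assume *: "x \<in> D (Some k) \<and> \<alpha> (Some k) x = y"
  have k: "k \<in> carrier G" using g h by (simp add: k_def)
  show "orbit g x = orbit h y"
  proof
    fix j
    show "orbit g x j = orbit h y j"
    proof (cases "j \<in> carrier G")
      case True
      have j: "(inv\<^bsub>G\<^esub> j \<otimes>\<^bsub>G\<^esub> h) \<otimes>\<^bsub>G\<^esub> k = inv\<^bsub>G\<^esub> j \<otimes>\<^bsub>G\<^esub> g"
        using True g h by (simp add: k_def m_assoc flip: m_assoc[of h])
      have c: "inv\<^bsub>G\<^esub> j \<otimes>\<^bsub>G\<^esub> h \<in> carrier G" using True h by simp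
      have "y \<in> D (Some (inv\<^bsub>G\<^esub> j \<otimes>\<^bsub>G\<^esub> h)) \<longleftrightarrow> x \<in> D (Some (inv\<^bsub>G\<^esub> j \<otimes>\<^bsub>G\<^esub> g))"
        using action_D_iff[of "Some k" "Some (inv\<^bsub>G\<^esub> j \<otimes>\<^bsub>G\<^esub> h)" x] * k c j by simp
      moreover have "\<alpha> (Some (inv\<^bsub>G\<^esub> j \<otimes>\<^bsub>G\<^esub> h)) y = \<alpha> (Some (inv\<^bsub>G\<^esub> j \<otimes>\<^bsub>G\<^esub> g)) x"
        if "y \<in> D (Some (inv\<^bsub>G\<^esub> j \<otimes>\<^bsub>G\<^esub> h))"
        using action_mult[of "Some k" "Some (inv\<^bsub>G\<^esub> j \<otimes>\<^bsub>G\<^esub> h)" x] * k c j that by simp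
      ultimately show ?thesis by (simp add: orbit_def)
    qed (simp add: orbit_def)
  qed
qed

text \<open>A quotient of \<open>X\<^sub>M\<close> in which products are single-valued but \<open>[e, X]\<close> is still a copy of \<open>X\<close>:
  \<open>[0, X]\<close> becomes the semigroup of traces, glued along \<open>im \<alpha>\<^sub>0\<close> to the translates \<open>[g, X]\<close>.\<close>

definition letter :: "'g option \<times> 'x \<Rightarrow> ('g \<Rightarrow> 'x option) + ('x option \<times> 'x option \<times> 'x) set" where
  "letter = (\<lambda>(m, x). case m of
     None \<Rightarrow> Inr (trace x)
   | Some g \<Rightarrow> if x \<in> I then Inr (trace x) else Inl (orbit g x))"

lemma letter_None_iff: "letter (None, x) = letter (None, y) \<longleftrightarrow> trace x = trace y"
  by (simp add: letter_def)

text \<open>Equality forces \<open>x\<close> into \<open>I\<close>, where the trace at the empty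
  context returns \<open>x\<close> itself; reading the same entry in \<open>trace y\<close> gives
  the claim. The converse is invariance of the trace.\<close>

lemma letter_Some_None_iff:
  "letter (Some g, x) = letter (None, y) \<longleftrightarrow> y \<in> D None \<and> \<alpha> None y = x"
proof
  assume "letter (Some g, x) = letter (None, y)"
  then have x: "x \<in> I" and "trace x = trace y" by (auto simp: letter_def split: if_splits)
  then have "(None, None, \<alpha> None x) \<in> trace y" using trace_one[of _ x] I_D[of None x] by auto
  then show "y \<in> D None \<and> \<alpha> None y = x" using I_fixed[OF _ x, of None] by (simp add: trace_one)
next
  assume "y \<in> D None \<and> \<alpha> None y = x"
  then show "letter (Some g, x) = letter (None, y)"
    using trace_action[of None y] by (auto simp: letter_def)
qed

text \<open>Outside \<open>I\<close> this is the criterion for orbits, since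
  \<open>\<alpha> (Some k)\<close> does not map points into \<open>I\<close> from outside. On
  \<open>I\<close> the map is the identity, and traces at the empty context distinguish
  points.\<close>

lemma letter_Some_iff:
  assumes g: "g \<in> carrier G" and h: "h \<in> carrier G" and x: "x \<in> carrier X" and y: "y \<in> carrier X"
  defines "k \<equiv> inv\<^bsub>G\<^esub> h \<otimes>\<^bsub>G\<^esub> g"
  shows "letter (Some g, x) = letter (Some h, y) \<longleftrightarrow> x \<in> D (Some k) \<and> \<alpha> (Some k) x = y"
proof -
  interpret group G by (rule group)
  have k: "k \<in> carrier G" using g h by (simp add: k_def)
  show ?thesis
  proof (cases "x \<in> I")
    case True
    have "x = y" if "y \<in> I" "trace x = trace y"
    proof -
      have "(None, None, x) \<in> trace x"
        using True I_D[of None x] I_fixed[of None x] by (simp add: trace_one)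
      then show ?thesis using that I_fixed[of None y] by (simp add: trace_one)
    qed
    moreover have "x \<in> D (Some k)" "\<alpha> (Some k) x = x"
      using True k I_D[of "Some k" x] I_fixed[of "Some k" x] by auto
    ultimately show ?thesis using True by (auto simp: letter_def)
  next
    case False
    then have "y \<notin> I" if "x \<in> D (Some k) \<and> \<alpha> (Some k) x = y"
      using action_I_iff[of k x] k that by auto
    with False show ?thesis
      using orbit_eq_iff[OF assms(1-4)] by (auto simp: letter_def k_def)
  qed
qed

text \<open>This makes \<open>letter\<close> descend to classes. The label \<open>n = 0\<close>
  needs invariance of the trace, \<open>k = 0\<close> under a group label is the gluing along
  \<open>I\<close>, and two group labels cancel to \<open>inv g\<close> times \<open>gh\<close>,
  which is \<open>h\<close>.\<close>

lemma letter_respects: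
  assumes n: "n \<in> carrier (adjoin_zero G)" and k: "k \<in> carrier (adjoin_zero G)" and x: "x \<in> D k"
  shows "letter (n \<otimes>\<^bsub>adjoin_zero G\<^esub> k, x) = letter (n, \<alpha> k x)"
proof (cases n)
  case None
  then show ?thesis using trace_action[OF k x] by (simp add: letter_None_iff)
next
  case (Some g)
  interpret group G by (rule group)
  show ?thesis
  proof (cases k)
    case None
    then show ?thesis using Some x letter_Some_None_iff[of g "\<alpha> None x" x] by simp
  next
    case (Some h)
    then show ?thesis
      using \<open>n = Some g\<close> n k x D_subset[OF k x] action_closed[OF k x]
        letter_Some_iff[of "g \<otimes>\<^bsub>G\<^esub> h" g x "\<alpha> k x"]
      by (simp flip: m_assoc)
  qed
qed

text \<open>In terms of points, equal letters are related by one map of the action, which is a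
  homomorphism, or have equal traces, which are multiplicative.\<close>

lemma letter_mult:
  assumes "m \<in> carrier (adjoin_zero G)" "n \<in> carrier (adjoin_zero G)"
    and X: "x \<in> carrier X" "y \<in> carrier X" "x' \<in> carrier X" "y' \<in> carrier X"
    and "letter (m, x) = letter (n, x')" "letter (m, y) = letter (n, y')"
  shows "letter (m, x \<cdot>\<^bsub>X\<^esub> y) = letter (n, x' \<cdot>\<^bsub>X\<^esub> y')"
proof -
  interpret group G by (rule group)
  have mixed: "letter (Some g, a \<cdot>\<^bsub>X\<^esub> b) = letter (None, a' \<cdot>\<^bsub>X\<^esub> b')"
    if "letter (Some g, a) = letter (None, a')" "letter (Some g, b) = letter (None, b')"
    for g a b a' b'
    using that D_subset[of None b'] by (simp add: letter_Some_None_iff D_mult action_hom)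
  show ?thesis
  proof (cases m; cases n)
    fix g h assume mn: "m = Some g" "n = Some h"
    then have "inv\<^bsub>G\<^esub> h \<otimes>\<^bsub>G\<^esub> g \<in> carrier G" using assms(1,2) by simp
    then show ?thesis
      using assms by (simp add: mn letter_Some_iff D_mult action_hom)
  next
    assume mn: "m = None" "n = None"
    then show ?thesis
      using assms by (simp add: letter_None_iff trace_mult[of x x' y y'])
  next
    fix g assume mn: "m = Some g" "n = None"
    then show ?thesis using assms by (auto intro: mixed)
  next
    fix h assume mn: "m = None" "n = Some h"
    then show ?thesis using assms mixed[of h x' x y' y] by simp
  qed
qed

section \<open>The partial multiplication of letters\<close>

text \<open>Two letters have a product only if they share a label; \<open>letter_mult\<close> shows
  that the choice of label does not matter.\<close>

definition letter_op where
  "letter_op c d p \<longleftrightarrow> (\<exists>m x y. m \<in> carrier (adjoin_zero G) \<and> x \<in> carrier X \<and> y \<in> carrier X \<and>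
     c = letter (m, x) \<and> d = letter (m, y) \<and> p = letter (m, x \<cdot>\<^bsub>X\<^esub> y))"

lemma letter_opI:
  "\<lbrakk>m \<in> carrier (adjoin_zero G); x \<in> carrier X; y \<in> carrier X\<rbrakk> \<Longrightarrow>
    letter_op (letter (m, x)) (letter (m, y)) (letter (m, x \<cdot>\<^bsub>X\<^esub> y))"
  by (auto simp: letter_op_def)

lemma letter_op_functional:
  "\<lbrakk>letter_op c d p; letter_op c d q\<rbrakk> \<Longrightarrow> p = q"
  unfolding letter_op_def using letter_mult by metis

text \<open>The critical pair: the middle letter carries both labels \<open>m\<close> and
  \<open>n\<close>. The ideal conditions let \<open>xy\<close> be relabelled by \<open>n\<close> as
  \<open>a\<close> and \<open>y'z\<close> by \<open>m\<close> as \<open>b\<close>, after which both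
  sides contract once more to the same letter.\<close>

lemma letter_op_assoc_aux:
  assumes mn: "m \<in> carrier (adjoin_zero G)" "n \<in> carrier (adjoin_zero G)"
    and X: "x \<in> carrier X" "y \<in> carrier X" "y' \<in> carrier X" "z \<in> carrier X"
    and y: "letter (m, y) = letter (n, y')"
  obtains a b where "a \<in> carrier X" "b \<in> carrier X"
    "letter (m, x \<cdot>\<^bsub>X\<^esub> y) = letter (n, a)" "letter (n, y' \<cdot>\<^bsub>X\<^esub> z) = letter (m, b)"
    "letter (n, a \<cdot>\<^bsub>X\<^esub> z) = letter (m, x \<cdot>\<^bsub>X\<^esub> b)"
proof (cases m; cases n)
  interpret group G by (rule group)
  fix g h assume eq: "m = Some g" "n = Some h"
  define k where "k = inv\<^bsub>G\<^esub> h \<otimes>\<^bsub>G\<^esub> g"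
  have g: "g \<in> carrier G" and h: "h \<in> carrier G" and k: "k \<in> carrier G"
    using mn eq by (auto simp: k_def)
  \<comment> \<open>Relabelling from \<open>h\<close> back to \<open>g\<close> uses the inverse of
    \<open>k\<close>.\<close>
  have ik: "inv\<^bsub>G\<^esub> k = inv\<^bsub>G\<^esub> g \<otimes>\<^bsub>G\<^esub> h" using g h by (simp add: k_def inv_mult_group)
  have yk: "y \<in> D (Some k)" "\<alpha> (Some k) y = y'"
    using y X g h by (simp_all add: eq letter_Some_iff k_def)
  let ?a = "\<alpha> (Some k) (x \<cdot>\<^bsub>X\<^esub> y)" and ?b = "\<alpha> (Some (inv\<^bsub>G\<^esub> k)) (y' \<cdot>\<^bsub>X\<^esub> z)"
  have xy: "x \<cdot>\<^bsub>X\<^esub> y \<in> D (Some k)" using yk k X by (simp add: D_mult)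
  have y'z: "y' \<cdot>\<^bsub>X\<^esub> z \<in> D (Some (inv\<^bsub>G\<^esub> k))" using yk k X D_inv[of k y] by (simp add: D_mult)
  have az: "?a \<cdot>\<^bsub>X\<^esub> z \<in> D (Some (inv\<^bsub>G\<^esub> k))" using xy k X D_inv[OF k xy] by (simp add: D_mult)
  have a: "?a \<in> carrier X" and b: "?b \<in> carrier X"
    using xy y'z k by (auto intro: action_closed)
  show thesis
  proof (rule that[OF a b])
    show "letter (m, x \<cdot>\<^bsub>X\<^esub> y) = letter (n, ?a)"
      using a X g h xy by (simp add: eq letter_Some_iff k_def)
    show "letter (n, y' \<cdot>\<^bsub>X\<^esub> z) = letter (m, ?b)"
      using b X g h y'z by (simp add: eq letter_Some_iff flip: ik)
    show "letter (n, ?a \<cdot>\<^bsub>X\<^esub> z) = letter (m, x \<cdot>\<^bsub>X\<^esub> ?b)"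
      \<comment> \<open>In terms of points, the goal says that applying the inverse map to
        \<open>a\<close> times \<open>z\<close> gives \<open>x\<close> times \<open>b\<close>; this
        is (LC1) for \<open>k\<close>.\<close>
      using a b X g h az LC1[OF k X(1) yk(1) X(4)] yk(2) by (simp add: eq letter_Some_iff flip: ik)
  qed
next
  assume eq: "m = None" "n = None"
  then have "trace (x \<cdot>\<^bsub>X\<^esub> y) = trace (x \<cdot>\<^bsub>X\<^esub> y')"
    using y X by (intro trace_mult) (simp_all add: letter_None_iff)
  then show thesis
    \<comment> \<open>With both labels zero only traces count, so \<open>y\<close> may be replaced
      by \<open>y'\<close>, and associativity in \<open>X\<close> does the rest.\<close>
    using that[of "x \<cdot>\<^bsub>X\<^esub> y'" "y' \<cdot>\<^bsub>X\<^esub> z"] X eq by (simp add: letter_None_iff X_assoc)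
next
  fix g assume eq: "m = Some g" "n = None"
  then have y': "y' \<in> D None" "y = \<alpha> None y'" using y by (auto simp: letter_Some_None_iff)
  then have "y \<in> I" "x \<cdot>\<^bsub>X\<^esub> y \<in> I" using X I_mult by auto
  have y'z: "y' \<cdot>\<^bsub>X\<^esub> z \<in> D None" using y' X by (simp add: D_mult)
  let ?b = "\<alpha> None (y' \<cdot>\<^bsub>X\<^esub> z)"
  have b: "?b \<in> carrier X" using y'z by (simp add: action_closed)
  have "trace y = trace y'" and b_trace: "trace ?b = trace (y' \<cdot>\<^bsub>X\<^esub> z)"
    using y' y'z by (simp_all add: trace_action)
  then have "trace (x \<cdot>\<^bsub>X\<^esub> (y \<cdot>\<^bsub>X\<^esub> z)) = trace (x \<cdot>\<^bsub>X\<^esub> ?b)"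
    using X b trace_mult[of x x "y \<cdot>\<^bsub>X\<^esub> z" ?b] trace_mult[of y y' z z] by simp
  \<comment> \<open>Inside \<open>I\<close> the letter with label \<open>g\<close> is the trace, so
    comparing traces settles the last equation.\<close>
  moreover have "x \<cdot>\<^bsub>X\<^esub> ?b \<in> I" using y'z X I_mult(2) by simp
  ultimately show thesis
    using that[of "x \<cdot>\<^bsub>X\<^esub> y" ?b] X b \<open>x \<cdot>\<^bsub>X\<^esub> y \<in> I\<close> y'z
    by (simp add: letter_def eq X_assoc b_trace)
next
  fix h assume eq: "m = None" "n = Some h"
  then have y': "y \<in> D None" "y' = \<alpha> None y" using y[symmetric] by (auto simp: letter_Some_None_iff)
  then have "y' \<cdot>\<^bsub>X\<^esub> z \<in> I" using X I_mult by auto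
  have xy: "x \<cdot>\<^bsub>X\<^esub> y \<in> D None" using y' X by (simp add: D_mult)
  let ?a = "\<alpha> None (x \<cdot>\<^bsub>X\<^esub> y)"
  have a: "?a \<in> carrier X" using xy by (simp add: action_closed)
  \<comment> \<open>The mirror image: now \<open>xy\<close> has label zero and is moved into
    \<open>I\<close> by \<open>\<alpha> None\<close>.\<close>
  have "trace y' = trace y" and a_trace: "trace ?a = trace (x \<cdot>\<^bsub>X\<^esub> y)"
    using y' xy by (simp_all add: trace_action)
  then have "trace (?a \<cdot>\<^bsub>X\<^esub> z) = trace (x \<cdot>\<^bsub>X\<^esub> (y' \<cdot>\<^bsub>X\<^esub> z))"
    using X a trace_mult[of ?a "x \<cdot>\<^bsub>X\<^esub> y" z z] trace_mult[of x x "y \<cdot>\<^bsub>X\<^esub> z" "y' \<cdot>\<^bsub>X\<^esub> z"]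
      trace_mult[of y y' z z] by (simp add: X_assoc)
  moreover have "?a \<cdot>\<^bsub>X\<^esub> z \<in> I" using xy X I_mult(1) by simp
  ultimately show thesis
    using that[of ?a "y' \<cdot>\<^bsub>X\<^esub> z"] X a \<open>y' \<cdot>\<^bsub>X\<^esub> z \<in> I\<close> xy
    by (simp add: letter_def eq a_trace)
qed

lemma letter_op_assoc:
  assumes "letter_op c d p" "letter_op d f q"
  shows "\<exists>r. letter_op p f r \<and> letter_op c q r"
proof -
  obtain m x y where 1: "m \<in> carrier (adjoin_zero G)" "x \<in> carrier X" "y \<in> carrier X"
    "c = letter (m, x)" "d = letter (m, y)" "p = letter (m, x \<cdot>\<^bsub>X\<^esub> y)"
    using assms(1) by (auto simp: letter_op_def)
  obtain n y' z where 2: "n \<in> carrier (adjoin_zero G)" "y' \<in> carrier X" "z \<in> carrier X"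
    "d = letter (n, y')" "f = letter (n, z)" "q = letter (n, y' \<cdot>\<^bsub>X\<^esub> z)"
    using assms(2) by (auto simp: letter_op_def)
  obtain a b where "a \<in> carrier X" "b \<in> carrier X" "p = letter (n, a)" "q = letter (m, b)"
    "letter (n, a \<cdot>\<^bsub>X\<^esub> z) = letter (m, x \<cdot>\<^bsub>X\<^esub> b)"
    using letter_op_assoc_aux[of m n x y y' z] 1 2 by auto
  then show ?thesis using letter_opI[of n a z] letter_opI[of m x b] 1 2 by auto
qed

section \<open>From congruent words to equal letters\<close>

abbreviation "word_equiv \<equiv> equivclp (contract letter_op)"

text \<open>Passing from classes to letters turns the generators of \<open>R\<close> into
  contractions, so congruent words have equivalent images. For one-letter words, confluence turns
  equivalence into equality.\<close>

lemma R_imp_letter_eq: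
  assumes m: "m \<in> carrier (adjoin_zero G)" "n \<in> carrier (adjoin_zero G)"
    and x: "x \<in> carrier X" "y \<in> carrier X"
    and R: "([cls m x], [cls n y]) \<in> R"
  shows "letter (m, x) = letter (n, y)"
proof -
  let ?h = "descend letter"
  \<comment> \<open>Taking the whole equivalence class as value expresses equivalence as equality,
    the form required by \<open>R_respects\<close>.\<close>
  let ?f = "\<lambda>w. Collect (word_equiv (map ?h w))"
  have h: "?h (cls m x) = letter (m, x)" if "m \<in> carrier (adjoin_zero G)" "x \<in> carrier X" for m x
    using that by (intro descend_cls letter_respects)
  have f_eq: "?f u = ?f v \<longleftrightarrow> word_equiv (map ?h u) (map ?h v)" for u v
    by (auto intro: equivclp_trans equivclp_sym)
  have "?f [cls m x] = ?f [cls n y]"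
    using R
  proof (rule R_respects[of ?f, rotated -1])
    fix a b c d
    assume "?f a = ?f b" "?f c = ?f d"
    then show "?f (a @ c) = ?f (b @ d)"
      unfolding f_eq by (simp add: equivclp_contract_append)
  next
    fix m x y assume "m \<in> carrier (adjoin_zero G)" "x \<in> carrier X" "y \<in> carrier X"
    then show "?f [cls m x, cls m y] = ?f [cls m (x \<cdot>\<^bsub>X\<^esub> y)]"
      unfolding f_eq using contractI[of letter_op, OF letter_opI, of m x y "[]" "[]"]
      by (auto simp: h)
  qed
  then have "word_equiv [letter (m, x)] [letter (n, y)]"
    unfolding f_eq using m x by (simp add: h)
  then show ?thesis
    by (rule equivclp_contract_singletons[rotated -1])
      (blast intro: letter_op_functional letter_op_assoc)+
qed

text \<open>With the identity as second label, \<open>letter_Some_iff\<close> has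
  \<open>k = g\<close>, and for \<open>m = 0\<close> the gluing criterion already has the required
  form.\<close>

lemma R_separates:
  assumes m: "m \<in> carrier (adjoin_zero G)" and x: "x \<in> carrier X" "y \<in> carrier X"
    and R: "([cls m x], [cls \<one>\<^bsub>adjoin_zero G\<^esub> y]) \<in> R"
  shows "x \<in> D m \<and> \<alpha> m x = y"
proof -
  interpret group G by (rule group)
  have eq: "letter (m, x) = letter (Some \<one>\<^bsub>G\<^esub>, y)"
    using R_imp_letter_eq[OF m _ x R] by simp
  show ?thesis
  proof (cases m)
    case None
    then show ?thesis using eq letter_Some_None_iff[of "\<one>\<^bsub>G\<^esub>" y x] by simp
  next
    case (Some g)
    then show ?thesis using eq m x by (simp add: letter_Some_iff)
  qed
qed

end

theorem proposition3p30:
  fixes G :: "('g, 'b) monoid_scheme" and X :: "'x magma"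
    and D :: "'g option \<Rightarrow> 'x set" and \<alpha> :: "'g option \<Rightarrow> 'x \<Rightarrow> 'x"
  assumes "group G" and "semigrp X"
    and "strong_partial_action (adjoin_zero G) X D \<alpha>"
    and "\<And>m. m \<in> carrier (adjoin_zero G) \<Longrightarrow> semigrp_ideal (D m) X"
    and "\<And>m. m \<in> carrier (adjoin_zero G) \<Longrightarrow> semigrp_ideal (\<alpha> m ` D m) X"
    and LC1: "\<And>g x y z. \<lbrakk>g \<in> carrier G; x \<in> carrier X; y \<in> D (Some g); z \<in> carrier X\<rbrakk> \<Longrightarrow>
       \<alpha> (Some (inv\<^bsub>G\<^esub> g)) (\<alpha> (Some g) (x \<cdot>\<^bsub>X\<^esub> y) \<cdot>\<^bsub>X\<^esub> z) =
       x \<cdot>\<^bsub>X\<^esub> \<alpha> (Some (inv\<^bsub>G\<^esub> g)) (\<alpha> (Some g) y \<cdot>\<^bsub>X\<^esub> z)"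
    and LC2: "\<And>m x y z w. \<lbrakk>m \<in> carrier (adjoin_zero G); y \<in> D m;
         x \<in> carrier (adjoin_one X); z \<in> carrier (adjoin_one X);
         x \<cdot>\<^bsub>adjoin_one X\<^esub> Some y \<cdot>\<^bsub>adjoin_one X\<^esub> z = Some w; w \<in> D None\<rbrakk> \<Longrightarrow>
       \<exists>w'. x \<cdot>\<^bsub>adjoin_one X\<^esub> Some (\<alpha> m y) \<cdot>\<^bsub>adjoin_one X\<^esub> z = Some w' \<and>
            w' \<in> D None \<and> \<alpha> None w = \<alpha> None w'"
  shows "universal_globalization TYPE('z) (adjoin_zero G) X D \<alpha>
           (XM_semigrp (adjoin_zero G) X D \<alpha>)
           (beta_bar (adjoin_zero G) X D \<alpha>)
           (iota_bar (adjoin_zero G) X D \<alpha>)"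
proof -
  interpret group_zero_action G X D \<alpha>
    using assms by (rule group_zero_action.intro)
  show ?thesis by (rule universal_globalizationI[OF R_separates])
qed

end
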